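(* Let $s\geq 1$, $d\geq 1$ and $m\geq 2$ be integers, and let $n=m-1$. For every admissible increment matrix $\kappa=(\kappa_1,\dots,\kappa_n)$ and every spot $j\in\mathbb{Z}_m$, $$\bigl|\{A\in\mathcal{C}_\kappa:\ E(A)=j\}\bigr|=m^{\,n-1},$$ where $\mathcal{C}_\kappa$ is the set of circular preferences with increment matrix $\kappa$ and $E(A)\in\mathbb{Z}_m$ is the unique spot left empty after circular parking with preference $A$.
   Context: Let $m\geq 2$. The spots are the elements of $\mathbb{Z}_m=\{1,\dots,m\}$, arranged clockwise on a circle. For $x\in\mathbb{Z}_m$ and an integer $k\geq 0$, $x\oplus k$ denotes clockwise displacement of $x$ by $k$, i.e. addition modulo $m$. Admissible tuples: fix integers $s\geq 1$ and $d\geq 1$. An admissible $s$-tuple is a tuple $(a_1,\dots,a_s)=\bigl(a,\ a\oplus k_1,\ a\oplus(k_1+k_2),\ \dots,\ a\oplus(k_1+\cdots+k_{s-1})\bigr)$ with $a\in\mathbb{Z}_m$ (the anchor) and integers $k_i\geq d$ for $1\le i\le s-1$ (the increments) such that $k_1+\cdots+k_{s-1}\leq m-d$ (for $s=1$ the sum is empty and equals $0$). Circular parking: let $n=m-1$. Cars $c_1,\dots,c_n$ enter in this order, each carrying an admissible $s$-tuple; all spots are initially free. Each car tries the spots of its tuple in the order $a_1,a_2,\dots,a_s$ and parks in the first one that is free; if all of them are occupied, it sweeps clockwise starting from its last choice $a_s$ (visiting $a_s\oplus 1, a_s\oplus 2,\dots$) and parks in the first free spot. A circular preference $A$ is a choice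 of an admissible $s$-tuple for each of the $n$ cars; the set of circular preferences is $\mathcal{C}_m^{s,d}$. Since $n<m$, every car parks and exactly one spot, denoted $E(A)$, remains empty. Increment classes: for a circular preference $A$, let $\kappa_i=(k_{1,i},\dots,k_{s-1,i})$ be the increment vector of the tuple of car $c_i$ ($1\le i\le n$); the increment matrix of $A$ is $\kappa=(\kappa_1,\dots,\kappa_n)$. An increment matrix $\kappa$ is admissible if for each $i$ the entries of $\kappa_i$ are integers $\geq d$ with $k_{1,i}+\cdots+k_{s-1,i}\leq m-d$. For such $\kappa$, $\mathcal{C}_\kappa=\{A\in\mathcal{C}_m^{s,d}: A\text{ has increment matrix }\kappa\}$. *)

theory Defs
  imports Main
begin

definition spots :: "nat \<Rightarrow> nat set" where
  "spots m = {1..m}"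

text \<open>Clockwise displacement: addition modulo \<open>m\<close> with representatives in \<open>{1..m}\<close>.\<close>

definition cshift :: "nat \<Rightarrow> nat \<Rightarrow> nat \<Rightarrow> nat" where
  "cshift m x k = Suc ((x + k - 1) mod m)"

text \<open>The tuple \<open>(a, a \<oplus> k\<^sub>1, a \<oplus> (k\<^sub>1 + k\<^sub>2), \<dots>)\<close>; its length is one more than that of \<open>ks\<close>.\<close>

definition tuple_of :: "nat \<Rightarrow> nat \<Rightarrow> nat list \<Rightarrow> nat list" where
  "tuple_of m a ks = map (\<lambda>i. cshift m a (sum_list (take i ks))) [0..<Suc (length ks)]"

text \<open>The bound is \<open>k\<^sub>1 + \<dots> + k\<^sub>s\<^sub>-\<^sub>1 \<le> m - d\<close> over the integers, written
  additively to avoid truncated subtraction: it is unsatisfiable when \<open>d > m\<close>.\<close>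

definition admissible_increments :: "nat \<Rightarrow> nat \<Rightarrow> nat \<Rightarrow> nat list \<Rightarrow> bool" where
  "admissible_increments m s d ks \<longleftrightarrow>
     length ks = s - 1 \<and> (\<forall>k\<in>set ks. d \<le> k) \<and> sum_list ks + d \<le> m"

definition admissible_tuple :: "nat \<Rightarrow> nat \<Rightarrow> nat \<Rightarrow> nat list \<Rightarrow> bool" where
  "admissible_tuple m s d t \<longleftrightarrow>
     (\<exists>a\<in>spots m. \<exists>ks. admissible_increments m s d ks \<and> t = tuple_of m a ks)"

text \<open>Well defined on admissible tuples when \<open>d \<ge> 1\<close>: see \<open>increment_vector_tuple_of\<close> below.\<close>

definition increment_vector :: "nat \<Rightarrow> nat \<Rightarrow> nat \<Rightarrow> nat list \<Rightarrow> nat list" where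
  "increment_vector m s d t =
     (THE ks. admissible_increments m s d ks \<and> (\<exists>a\<in>spots m. t = tuple_of m a ks))"

text \<open>A circular preference lists the tuples of the \<open>m - 1\<close> cars in order of entry.\<close>

definition circular_prefs :: "nat \<Rightarrow> nat \<Rightarrow> nat \<Rightarrow> nat list list set" where
  "circular_prefs m s d = {A. length A = m - 1 \<and> (\<forall>t\<in>set A. admissible_tuple m s d t)}"

definition increment_matrix :: "nat \<Rightarrow> nat \<Rightarrow> nat \<Rightarrow> nat list list \<Rightarrow> nat list list" where
  "increment_matrix m s d A = map (increment_vector m s d) A"

definition admissible_increment_matrix :: "nat \<Rightarrow> nat \<Rightarrow> nat \<Rightarrow> nat list list \<Rightarrow> bool" where
  "admissible_increment_matrix m s d \<kappa> \<longleftrightarrow>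
     length \<kappa> = m - 1 \<and> (\<forall>ks\<in>set \<kappa>. admissible_increments m s d ks)"

definition increment_class :: "nat \<Rightarrow> nat \<Rightarrow> nat \<Rightarrow> nat list list \<Rightarrow> nat list list set" where
  "increment_class m s d \<kappa> = {A \<in> circular_prefs m s d. increment_matrix m s d A = \<kappa>}"

definition parking_spot :: "nat \<Rightarrow> nat set \<Rightarrow> nat list \<Rightarrow> nat" where
  "parking_spot m Occ t =
     (case find (\<lambda>x. x \<notin> Occ) t of
        Some x \<Rightarrow> x
      | None \<Rightarrow> cshift m (last t) (LEAST k. 1 \<le> k \<and> cshift m (last t) k \<notin> Occ))"

definition occupied :: "nat \<Rightarrow> nat list list \<Rightarrow> nat set" where
  "occupied m A = foldl (\<lambda>Occ t. insert (parking_spot m Occ t) Occ) {} A"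

definition empty_spot :: "nat \<Rightarrow> nat list list \<Rightarrow> nat" where
  "empty_spot m A = (THE j. j \<in> spots m \<and> j \<notin> occupied m A)"

text \<open>The two definite descriptions above are meaningful.\<close>

lemma cshift_in_spots: "0 < m \<Longrightarrow> cshift m x k \<in> spots m"
  by (simp add: cshift_def spots_def Suc_le_eq)

lemma cshift_inj:
  assumes "cshift m a p = cshift m a q" "a \<in> spots m" "p < m" "q < m"
  shows "p = q"
proof -
  have le: "p = q"
    if "((a - 1) + p) mod m = ((a - 1) + q) mod m" "p \<le> q" "q < m" for p q :: nat
  proof -
    have "m dvd (a - 1 + q) - (a - 1 + p)"
      using that(1,2) mod_eq_dvd_iff_nat[of "a - 1 + p" "a - 1 + q" m] by simp
    then have "m dvd q - p" by simp
    then show ?thesis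
      using that(2,3) by (cases "q = p") (auto dest: dvd_imp_le)
  qed
  have "((a - 1) + p) mod m = ((a - 1) + q) mod m"
    using assms(1,2) by (simp add: cshift_def spots_def)
  then show ?thesis using le[of p q] le[of q p] assms(3,4) by (metis nat_le_linear)
qed

lemma tuple_of_nth:
  "i \<le> length ks \<Longrightarrow> tuple_of m a ks ! i = cshift m a (sum_list (take i ks))"
  by (simp add: tuple_of_def del: upt_Suc)

lemma cshift_0: "a \<in> spots m \<Longrightarrow> cshift m a 0 = a"
  by (cases a) (auto simp: cshift_def spots_def)

lemma tuple_of_inj:
  assumes eq: "tuple_of m a ks = tuple_of m b ls" and d: "1 \<le> d"
    and a: "a \<in> spots m" and b: "b \<in> spots m"
    and ks: "admissible_increments m s d ks" and ls: "admissible_increments m s d ls"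
  shows "a = b" "ks = ls"
proof -
  have len: "length ks = length ls" using ks ls by (simp add: admissible_increments_def)
  show ab: "a = b"
    using tuple_of_nth[of 0 ks m a] tuple_of_nth[of 0 ls m b] eq a b by (simp add: cshift_0)
  have lt: "sum_list (take i xs) < m" if "admissible_increments m s d xs" for i xs
  proof -
    have "sum_list xs = sum_list (take i xs) + sum_list (drop i xs)"
      by (metis append_take_drop_id sum_list_append)
    then show ?thesis using that d by (simp add: admissible_increments_def)
  qed
  have S: "sum_list (take i ks) = sum_list (take i ls)" if "i \<le> length ks" for i
  proof (rule cshift_inj[OF _ a lt[OF ks] lt[OF ls]])
    show "cshift m a (sum_list (take i ks)) = cshift m a (sum_list (take i ls))"
      using tuple_of_nth[of i ks m a] tuple_of_nth[of i ls m b] eq that len ab by simp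
  qed
  show "ks = ls"
  proof (rule nth_equalityI[OF len])
    fix i assume i: "i < length ks"
    have "sum_list (take (Suc i) ks) = sum_list (take i ks) + ks ! i"
      "sum_list (take (Suc i) ls) = sum_list (take i ls) + ls ! i"
      using i len by (simp_all add: take_Suc_conv_app_nth)
    then show "ks ! i = ls ! i" using S[of i] S[of "Suc i"] i by simp
  qed
qed

lemma increment_vector_tuple_of:
  assumes "1 \<le> d" "a \<in> spots m" "admissible_increments m s d ks"
  shows "increment_vector m s d (tuple_of m a ks) = ks"
  unfolding increment_vector_def
proof (rule the_equality)
  show "admissible_increments m s d ks \<and> (\<exists>b\<in>spots m. tuple_of m a ks = tuple_of m b ks)"
    using assms by blast
next
  fix ls assume "admissible_increments m s d ls \<and> (\<exists>b\<in>spots m. tuple_of m a ks = tuple_of m b ls)"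
  then show "ls = ks" using tuple_of_inj(2)[of m a ks _ ls d s] assms by metis
qed

lemma parking_spot_free:
  assumes "Occ \<subset> spots m" "t \<noteq> []" "set t \<subseteq> spots m"
  shows "parking_spot m Occ t \<in> spots m - Occ"
proof (cases "find (\<lambda>x. x \<notin> Occ) t")
  case None
  obtain y where y: "y \<in> spots m" "y \<notin> Occ" using assms(1) by blast
  have m: "0 < m" using y by (simp add: spots_def)
  have l: "last t \<in> spots m" using assms(2,3) last_in_set by blast
  have "cshift m (last t) (m + y - last t) = y"
  proof -
    have "last t + (m + y - last t) - 1 = (y - 1) + m" using y(1) l by (auto simp: spots_def)
    then have "cshift m (last t) (m + y - last t) = Suc ((y - 1 + m) mod m)"
      by (simp only: cshift_def)
    also have "\<dots> = y" using y(1) by (cases y) (auto simp: spots_def)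
    finally show ?thesis .
  qed
  moreover have "1 \<le> m + y - last t" using y(1) l by (auto simp: spots_def)
  ultimately have "\<exists>k. 1 \<le> k \<and> cshift m (last t) k \<notin> Occ" using y(2) by metis
  from LeastI_ex[OF this] show ?thesis
    using None cshift_in_spots[OF m] by (simp add: parking_spot_def)
next
  case (Some x)
  then have "x \<in> set t" "x \<notin> Occ" by (auto simp: find_Some_iff)
  then show ?thesis using Some assms(3) by (auto simp: parking_spot_def)
qed

lemma occupied_card:
  assumes "length A < m" "\<forall>t\<in>set A. t \<noteq> [] \<and> set t \<subseteq> spots m"
  shows "occupied m A \<subseteq> spots m \<and> card (occupied m A) = length A"
  using assms
proof (induction A rule: rev_induct)
  case Nil
  then show ?case by (simp add: occupied_def)
next
  case (snoc t A)
  then have IH: "occupied m A \<subseteq> spots m" "card (occupied m A) = length A" by auto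
  have "card (occupied m A) < card (spots m)" using IH snoc.prems by (simp add: spots_def)
  then have "occupied m A \<subset> spots m" using IH(1) by (metis psubsetI less_irrefl)
  then have f: "parking_spot m (occupied m A) t \<in> spots m - occupied m A"
    using snoc.prems parking_spot_free by simp
  have fin: "finite (occupied m A)"
    using IH(1) by (rule finite_subset) (simp add: spots_def)
  have "occupied m (A @ [t]) = insert (parking_spot m (occupied m A) t) (occupied m A)"
    by (simp add: occupied_def)
  then show ?case using f fin IH by simp
qed

lemma empty_spot_unique:
  assumes m: "0 < m" and A: "A \<in> circular_prefs m s d"
  shows "\<exists>!j. j \<in> spots m \<and> j \<notin> occupied m A"
proof -
  have "\<forall>t\<in>set A. t \<noteq> [] \<and> set t \<subseteq> spots m"
  proof
    fix t assume "t \<in> set A"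
    then obtain a ks where "t = tuple_of m a ks"
      using A unfolding circular_prefs_def admissible_tuple_def by blast
    then show "t \<noteq> [] \<and> set t \<subseteq> spots m"
      using cshift_in_spots[OF m] by (auto simp: tuple_of_def simp del: upt_Suc)
  qed
  then have o: "occupied m A \<subseteq> spots m" "card (occupied m A) = m - 1"
    using occupied_card[of A m] A m by (auto simp: circular_prefs_def)
  have "card (spots m - occupied m A) = 1"
    using card_Diff_subset[OF finite_subset[OF o(1)] o(1)] o m by (simp add: spots_def)
  then obtain x where "spots m - occupied m A = {x}" by (rule card_1_singletonE)
  then show ?thesis by (metis Diff_iff singleton_iff)
qed

end

theory Submission
  imports Defs
begin

text \<open>Rotating every tuple of a preference by \<open>r\<close> keeps the increments and rotates the whole parking
  process, hence moves the empty spot by \<open>r\<close>. So the \<open>m\<close> fibres of \<open>E\<close> on \<open>\<C>\<^sub>\<kappa>\<close>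
  are equinumerous, while \<open>\<C>\<^sub>\<kappa>\<close> has \<open>m ^ n\<close> elements, one for each choice of the \<open>n\<close> anchors.\<close>

section \<open>Rotations of the circle of spots\<close>

lemma cshift_cshift:
  assumes "1 \<le> x"
  shows "cshift m (cshift m x k) l = cshift m x (k + l)"
proof -
  \<comment> \<open>Writing \<open>x\<close> as a successor removes the truncated \<open>- 1\<close>
    in \<open>cshift\<close>; for \<open>x = 0\<close>, \<open>k = 0\<close> the truncation would
    break additivity.\<close>
  obtain y where "x = Suc y" using assms by (cases x) auto
  then show ?thesis by (simp add: cshift_def mod_add_left_eq add.assoc)
qed

lemma cshift_cshift_commute:
  assumes "1 \<le> x"
  shows "cshift m (cshift m x k) l = cshift m (cshift m x l) k"
  using assms by (simp add: cshift_cshift add.commute)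

lemma cshift_mult_self:
  assumes "x \<in> spots m"
  shows "cshift m x (m * r) = x"
  using assms by (cases x) (auto simp: cshift_def spots_def)

lemma inj_on_cshift: "inj_on (\<lambda>x. cshift m x r) (spots m)"
proof (rule inj_on_inverseI)
  fix x assume x: "x \<in> spots m"
  then have "1 \<le> x" "1 \<le> m" by (auto simp: spots_def)
  \<comment> \<open>The inverse rotation completes \<open>r\<close> full turns. Unlike
    \<open>m - r\<close>, the difference \<open>m * r - r\<close> is never truncated, even for
    \<open>r > m\<close>.\<close>
  then have "cshift m (cshift m x r) (m * r - r) = cshift m x (m * r)"
    by (simp add: cshift_cshift)
  then show "cshift m (cshift m x r) (m * r - r) = x"
    using cshift_mult_self[OF x] by simp
qed

lemma cshift_transitive:
  assumes "x \<in> spots m" "y \<in> spots m"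
  obtains r where "cshift m x r = y"
proof
  \<comment> \<open>Since \<open>x \<le> m\<close>, this displacement leads to \<open>m + y\<close>,
    one full turn past \<open>y\<close>.\<close>
  show "cshift m x (m - x + y) = y"
    using assms by (cases y) (auto simp: cshift_def spots_def)
qed

section \<open>Equivariance of parking under rotation\<close>

lemma tuple_of_cshift:
  assumes "a \<in> spots m"
  shows "tuple_of m (cshift m a r) ks = map (\<lambda>x. cshift m x r) (tuple_of m a ks)"
  using assms cshift_cshift_commute[of a m r] by (auto simp: tuple_of_def spots_def simp del: upt_Suc)

lemma tuple_of_nonempty: "tuple_of m a ks \<noteq> []"
  by (simp add: tuple_of_def)

lemma set_tuple_of_subset: "0 < m \<Longrightarrow> set (tuple_of m a ks) \<subseteq> spots m"
  using cshift_in_spots by (auto simp: tuple_of_def simp del: upt_Suc)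

text \<open>A rotation is injective on the spots, so it preserves and reflects being occupied. The
  car thus succeeds at the same position of its tuple, or sweeps the same distance.\<close>

lemma parking_spot_cshift:
  assumes m: "0 < m" and Occ: "Occ \<subseteq> spots m" and t: "t \<noteq> []" "set t \<subseteq> spots m"
  shows "parking_spot m ((\<lambda>x. cshift m x r) ` Occ) (map (\<lambda>x. cshift m x r) t) =
    cshift m (parking_spot m Occ t) r"
proof -
  let ?f = "\<lambda>x. cshift m x r"
  have mem: "?f x \<in> ?f ` Occ \<longleftrightarrow> x \<in> Occ" if "x \<in> spots m" for x
    using inj_on_image_mem_iff[OF inj_on_cshift that Occ] .
  have "last t \<in> spots m" using t last_in_set by blast
  then have l: "1 \<le> last t" by (simp add: spots_def)
  have "find (\<lambda>x. x \<notin> ?f ` Occ) (map ?f t) = map_option ?f (find (\<lambda>x. x \<notin> Occ) t)"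
    using t(2) by (induction t) (auto simp: mem)
  \<comment> \<open>The predicates under \<open>LEAST\<close> agree at every \<open>k\<close>, hence
    so do the sweep lengths.\<close>
  moreover have "(cshift m (last (map ?f t)) k \<notin> ?f ` Occ) = (cshift m (last t) k \<notin> Occ)" for k
    using mem[OF cshift_in_spots[OF m]] cshift_cshift_commute[OF l] t(1) by (simp add: last_map)
  ultimately show ?thesis
    using cshift_cshift_commute[OF l] t(1)
    by (simp add: parking_spot_def last_map split: option.split)
qed

lemma occupied_cshift:
  assumes "length A < m" "\<forall>t\<in>set A. t \<noteq> [] \<and> set t \<subseteq> spots m"
  shows "occupied m (map (map (\<lambda>x. cshift m x r)) A) = (\<lambda>x. cshift m x r) ` occupied m A"
  using assms
proof (induction A rule: rev_induct)
  case Nil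
  then show ?case by (simp add: occupied_def)
next
  case (snoc t A)
  \<comment> \<open>Here the bound on the number of cars enters; \<open>parking_spot_cshift\<close>
    needs this inclusion because rotations are injective only on \<open>spots m\<close>.\<close>
  have "occupied m A \<subseteq> spots m" using snoc.prems occupied_card[of A m] by simp
  then have "parking_spot m ((\<lambda>x. cshift m x r) ` occupied m A) (map (\<lambda>x. cshift m x r) t) =
      cshift m (parking_spot m (occupied m A) t) r"
    using snoc.prems by (intro parking_spot_cshift) auto
  moreover have "occupied m (B @ [u]) = insert (parking_spot m (occupied m B) u) (occupied m B)"
    for B u by (simp add: occupied_def)
  ultimately show ?case using snoc by simp
qed

lemma circular_prefs_tuples:
  assumes "0 < m" "A \<in> circular_prefs m s d"
  shows "length A < m" "\<forall>t\<in>set A. t \<noteq> [] \<and> set t \<subseteq> spots m"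
proof -
  show "length A < m" using assms by (simp add: circular_prefs_def)
  show "\<forall>t\<in>set A. t \<noteq> [] \<and> set t \<subseteq> spots m"
  proof
    fix t assume "t \<in> set A"
    then obtain a ks where "t = tuple_of m a ks"
      using assms(2) unfolding circular_prefs_def admissible_tuple_def by blast
    then show "t \<noteq> [] \<and> set t \<subseteq> spots m"
      by (simp add: tuple_of_nonempty set_tuple_of_subset[OF assms(1)])
  qed
qed

lemma empty_spot_in_spots:
  assumes "0 < m" "A \<in> circular_prefs m s d"
  shows "empty_spot m A \<in> spots m" "empty_spot m A \<notin> occupied m A"
  using theI'[OF empty_spot_unique[OF assms]] by (simp_all add: empty_spot_def)

lemma empty_spot_cshift:
  assumes m: "0 < m" and A: "A \<in> circular_prefs m s d"
    and B: "map (map (\<lambda>x. cshift m x r)) A \<in> circular_prefs m s d"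
  shows "empty_spot m (map (map (\<lambda>x. cshift m x r)) A) = cshift m (empty_spot m A) r"
  \<comment> \<open>Only the left-hand description is unfolded: it then suffices that the rotated
    old empty spot is free, as uniqueness does the rest.\<close>
  unfolding empty_spot_def[of m "map _ A"]
proof (rule the1_equality[OF empty_spot_unique[OF m B]])
  have o: "occupied m A \<subseteq> spots m"
    using occupied_card circular_prefs_tuples[OF m A] by blast
  show "cshift m (empty_spot m A) r \<in> spots m \<and>
    cshift m (empty_spot m A) r \<notin> occupied m (map (map (\<lambda>x. cshift m x r)) A)"
    using cshift_in_spots[OF m] empty_spot_in_spots[OF m A]
      inj_on_image_mem_iff[OF inj_on_cshift empty_spot_in_spots(1)[OF m A] o]
    by (simp add: occupied_cshift[OF circular_prefs_tuples[OF m A]])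
qed

section \<open>Increment classes parametrised by anchors\<close>

definition anchor_lists :: "nat \<Rightarrow> nat list set" where
  "anchor_lists m = {as. set as \<subseteq> spots m \<and> length as = m - 1}"

text \<open>With its increments fixed, a tuple is given by its anchor. By \<open>1 \<le> d\<close>
  all partial sums stay below \<open>m\<close>, so \<open>increment_vector\<close> recovers the
  increments from the tuple.\<close>

lemma increment_class_eq:
  assumes d: "1 \<le> d" and \<kappa>: "admissible_increment_matrix m s d \<kappa>"
  shows "increment_class m s d \<kappa> = (\<lambda>as. map2 (tuple_of m) as \<kappa>) ` anchor_lists m"
    (is "?C = ?g ` _")
proof
  have len: "length \<kappa> = m - 1" and adm: "\<And>i. i < m - 1 \<Longrightarrow> admissible_increments m s d (\<kappa> ! i)"
    using \<kappa> by (auto simp: admissible_increment_matrix_def)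
  show "?g ` anchor_lists m \<subseteq> ?C"
  proof (rule image_subsetI)
    fix as assume "as \<in> anchor_lists m"
    then have l: "length as = m - 1" and a: "\<And>i. i < m - 1 \<Longrightarrow> as ! i \<in> spots m"
      by (force simp: anchor_lists_def)+
    have "?g as \<in> circular_prefs m s d"
      using l len a adm
      by (fastforce simp: circular_prefs_def in_set_conv_nth admissible_tuple_def)
    moreover have "increment_matrix m s d (?g as) = \<kappa>"
      using l len a adm increment_vector_tuple_of[OF d]
      by (auto simp: increment_matrix_def intro!: nth_equalityI)
    ultimately show "?g as \<in> ?C" by (simp add: increment_class_def)
  qed
  show "?C \<subseteq> ?g ` anchor_lists m"
  proof
    fix A assume A: "A \<in> ?C"
    then have l: "length A = m - 1" and mat: "map (increment_vector m s d) A = \<kappa>"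
      by (auto simp: increment_class_def circular_prefs_def increment_matrix_def)
    have "\<exists>a. a \<in> spots m \<and> A ! i = tuple_of m a (\<kappa> ! i)" if i: "i < m - 1" for i
    proof -
      have "admissible_tuple m s d (A ! i)"
        using A l i by (auto simp: increment_class_def circular_prefs_def)
      then obtain a ks where a: "a \<in> spots m" "admissible_increments m s d ks"
        "A ! i = tuple_of m a ks" by (auto simp: admissible_tuple_def)
      moreover have "\<kappa> ! i = increment_vector m s d (A ! i)"
        using mat l i by auto
      ultimately show ?thesis using increment_vector_tuple_of[OF d a(1,2)] by auto
    qed
    \<comment> \<open>One anchor is chosen per car; tabulating \<open>f\<close> gives the required
      anchor list.\<close>
    then obtain f where f: "\<And>i. i < m - 1 \<Longrightarrow> f i \<in> spots m \<and> A ! i = tuple_of m (f i) (\<kappa> ! i)"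
      by metis
    have "A = ?g (map f [0..<m - 1])"
      using l len f by (auto intro!: nth_equalityI)
    moreover have "map f [0..<m - 1] \<in> anchor_lists m"
      using f by (auto simp: anchor_lists_def)
    ultimately show "A \<in> ?g ` anchor_lists m" by blast
  qed
qed

lemma inj_on_anchor_lists:
  assumes "length \<kappa> = m - 1"
  shows "inj_on (\<lambda>as. map2 (tuple_of m) as \<kappa>) (anchor_lists m)"
proof (rule inj_onI)
  fix as bs
  assume as: "as \<in> anchor_lists m" and bs: "bs \<in> anchor_lists m"
    and eq: "map2 (tuple_of m) as \<kappa> = map2 (tuple_of m) bs \<kappa>"
  have l: "length as = m - 1" "length bs = m - 1"
    using as bs by (auto simp: anchor_lists_def)
  show "as = bs"
  proof (rule nth_equalityI)
    fix i assume i: "i < length as"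
    have s: "as ! i \<in> spots m" "bs ! i \<in> spots m"
      using as bs i l by (auto simp: anchor_lists_def dest!: nth_mem)
    have "tuple_of m (as ! i) (\<kappa> ! i) = tuple_of m (bs ! i) (\<kappa> ! i)"
      using arg_cong[OF eq, of "\<lambda>xs. xs ! i"] i l assms by simp
    \<comment> \<open>Entry 0 of a tuple is its anchor displaced by 0.\<close>
    from arg_cong[OF this, of "\<lambda>t. t ! 0"] show "as ! i = bs ! i"
      using s by (simp add: tuple_of_nth cshift_0)
  qed (simp add: l)
qed

section \<open>Sizes of a class and of its fibres\<close>

lemma card_increment_class:
  assumes "1 \<le> d" "admissible_increment_matrix m s d \<kappa>"
  shows "card (increment_class m s d \<kappa>) = m ^ (m - 1)"
proof -
  have "length \<kappa> = m - 1" using assms(2) by (simp add: admissible_increment_matrix_def)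
  then have "card (increment_class m s d \<kappa>) = card (anchor_lists m)"
    using increment_class_eq[OF assms] by (simp add: card_image inj_on_anchor_lists)
  also have "\<dots> = m ^ (m - 1)"
    unfolding anchor_lists_def by (subst card_lists_length_eq) (simp_all add: spots_def)
  finally show ?thesis .
qed

text \<open>Rotating a tuple amounts to rotating its anchor, so on anchor lists the rotation acts
  entrywise and leaves \<kappa> alone. This route avoids evaluating \<open>increment_vector\<close>
  on rotated tuples.\<close>

lemma increment_class_cshift:
  assumes m: "0 < m" and "1 \<le> d" "admissible_increment_matrix m s d \<kappa>"
    and "A \<in> increment_class m s d \<kappa>"
  shows "map (map (\<lambda>x. cshift m x r)) A \<in> increment_class m s d \<kappa>"
proof -
  obtain as where as: "as \<in> anchor_lists m" "A = map2 (tuple_of m) as \<kappa>"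
    using assms increment_class_eq by blast
  have "map (map (\<lambda>x. cshift m x r)) A = map2 (tuple_of m) (map (\<lambda>x. cshift m x r) as) \<kappa>"
  proof (rule nth_equalityI)
    fix i assume "i < length (map (map (\<lambda>x. cshift m x r)) A)"
    then have i: "i < length as" "i < length \<kappa>" using as(2) by auto
    then have "as ! i \<in> spots m" using as(1) by (auto simp: anchor_lists_def)
    then show "map (map (\<lambda>x. cshift m x r)) A ! i =
        map2 (tuple_of m) (map (\<lambda>x. cshift m x r) as) \<kappa> ! i"
      using i as(2) by (simp add: tuple_of_cshift)
  qed (simp add: as(2))
  moreover have "map (\<lambda>x. cshift m x r) as \<in> anchor_lists m"
    using as(1) cshift_in_spots[OF m] by (auto simp: anchor_lists_def)
  ultimately show ?thesis using increment_class_eq[OF assms(2,3)] by blast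
qed

text \<open>The rotation taking \<open>i\<close> to \<open>j\<close> injects one fibre into the
  other. As both spots are arbitrary, exchanging them gives equality.\<close>

lemma card_fibre_le:
  assumes m: "0 < m" and d: "1 \<le> d" and \<kappa>: "admissible_increment_matrix m s d \<kappa>"
    and i: "i \<in> spots m" and j: "j \<in> spots m"
  shows "card {A \<in> increment_class m s d \<kappa>. empty_spot m A = i} \<le>
    card {A \<in> increment_class m s d \<kappa>. empty_spot m A = j}"
proof -
  obtain r where r: "cshift m i r = j" using cshift_transitive[OF i j] .
  let ?F = "\<lambda>i. {A \<in> increment_class m s d \<kappa>. empty_spot m A = i}"
  let ?R = "map (map (\<lambda>x. cshift m x r))"
  have C: "increment_class m s d \<kappa> \<subseteq> circular_prefs m s d" by (auto simp: increment_class_def)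
  have "inj_on ?R (lists (lists (spots m)))"
    by (intro inj_on_mapI inj_on_subset[OF inj_on_cshift] inj_on_subset[OF inj_on_mapI]) auto
  moreover have "?F i \<subseteq> lists (lists (spots m))"
    using C circular_prefs_tuples(2)[OF m] by fastforce
  ultimately have "inj_on ?R (?F i)" by (rule inj_on_subset)
  moreover have "?R ` ?F i \<subseteq> ?F j"
  proof (rule image_subsetI)
    fix A assume A: "A \<in> ?F i"
    then have RA: "?R A \<in> increment_class m s d \<kappa>"
      using increment_class_cshift[OF m d \<kappa>] by simp
    have "empty_spot m (?R A) = cshift m (empty_spot m A) r"
      using A C RA by (intro empty_spot_cshift[OF m, of _ s d]) auto
    then show "?R A \<in> ?F j" using A RA r by simp
  qed
  \<comment> \<open>Infinite sets have \<open>card\<close> 0, so the positive value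
    \<open>m ^ (m - 1)\<close> forces finiteness.\<close>
  moreover have "finite (increment_class m s d \<kappa>)"
    using m card_increment_class[OF d \<kappa>] by (intro card_ge_0_finite) simp
  ultimately show ?thesis by (intro card_inj_on_le) auto
qed

theorem theorem2:
  fixes m s d n j :: nat and \<kappa> :: "nat list list"
  assumes "1 \<le> s" and "1 \<le> d" and "2 \<le> m" and "n = m - 1"
    and "admissible_increment_matrix m s d \<kappa>"
    and "j \<in> spots m"
  shows "card {A \<in> increment_class m s d \<kappa>. empty_spot m A = j} = m ^ (n - 1)"
proof -
  let ?C = "increment_class m s d \<kappa>"
  let ?F = "\<lambda>i. {A \<in> ?C. empty_spot m A = i}"
  have m: "0 < m" using assms(3) by simp
  have fin: "finite ?C"
    using m card_increment_class[OF assms(2,5)] by (intro card_ge_0_finite) simp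
  have "empty_spot m ` ?C \<subseteq> spots m"
    using empty_spot_in_spots(1)[OF m] by (auto simp: increment_class_def)
  \<comment> \<open>The constant 1 is summed over the class, grouped by empty spot.\<close>
  then have "card ?C = (\<Sum>i\<in>spots m. card (?F i))"
    using fin sum.group[of ?C "spots m" "empty_spot m" "\<lambda>_. 1::nat"] by (simp add: spots_def)
  also have "\<dots> = (\<Sum>i\<in>spots m. card (?F j))"
    using card_fibre_le[OF m assms(2,5)] assms(6) by (intro sum.cong refl antisym) auto
  also have "\<dots> = m * card (?F j)" by (simp add: spots_def)
  finally have "m * card (?F j) = m ^ n"
    using card_increment_class[OF assms(2,5)] assms(4) by simp
  \<comment> \<open>From \<open>2 \<le> m\<close> follows \<open>n \<noteq> 0\<close>, so
    \<open>n - 1\<close> is not truncated and a factor \<open>m\<close> splits off for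
    cancellation.\<close>
  also have "\<dots> = m * m ^ (n - 1)"
    using assms(3,4) by (intro power_eq_if[THEN trans]) simp
  finally show ?thesis using m by simp
qed

end
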